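(* Let $G$ be a connected graph of order $n\ge 3$ containing a cycle, with girth $g$. Then $$EUS(G)\geq \begin{cases} 2\sqrt{3}\,n & \text{if } g=n,\\ 2\sqrt{3}\,(n-3)+2\sqrt{19}+\sqrt{13} & \text{if } g=n-1,\\ 3\sqrt{19}+2(n-4)\sqrt{3}+\sqrt{7} & \text{if } g\le n-2,\end{cases}$$ with equality if and only if $G\cong C_n$ (for $g=n$), $G\cong C_{n,n-1}$ (for $g=n-1$), or $G\cong C_{n,g}$ (for $g\le n-2$).
   Context: For a simple graph $G$, the Euler Sombor index is $EUS(G)=\sum_{v_iv_j\in E(G)}\sqrt{d_i^2+d_j^2+d_id_j}$, where $d_i$ denotes the degree of vertex $v_i$. The girth of a graph is the length of its shortest cycle. $C_n$ is the cycle on $n$ vertices. For $g<n$, $C_{n,g}$ denotes the unicyclic graph of order $n$ and girth $g$ obtained by attaching a pendant path $P_{n-g}$ (on $n-g$ new vertices) to a single vertex of the cycle $C_g$ by an edge. *)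

theory Defs
  imports Complex_Main "Graph_Theory.Graph_Theory"
begin

(* A finite simple graph is a pair_graph: a finite loop-free symmetric set of arcs without
   parallel arcs.  An undirected edge is a pair of opposite arcs, hence out_degree is the
   degree of a vertex. *)

definition edges :: "'a pair_pre_digraph \<Rightarrow> 'a set set" where
  "edges G = {{u, v} | u v. (u, v) \<in> parcs G}"

(* The graph being loop-free, an edge e = {u, v} has exactly two elements, and the radicand is
   d_u^2 + d_v^2 + d_u d_v; see EUS_summand. *)
definition EUS :: "'a pair_pre_digraph \<Rightarrow> real" where
  "EUS G = (\<Sum>e\<in>edges G.
     sqrt ((\<Sum>v\<in>e. real (out_degree (with_proj G) v) ^ 2)
           + (\<Prod>v\<in>e. real (out_degree (with_proj G) v))))"

lemma EUS_summand:
  assumes "pair_graph G" "(u, v) \<in> parcs G"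
  shows "sqrt ((\<Sum>x\<in>{u, v}. real (out_degree (with_proj G) x) ^ 2)
               + (\<Prod>x\<in>{u, v}. real (out_degree (with_proj G) x)))
       = sqrt (real (out_degree (with_proj G) u) ^ 2 + real (out_degree (with_proj G) v) ^ 2
               + real (out_degree (with_proj G) u) * real (out_degree (with_proj G) v))"
proof -
  interpret pair_graph G by fact
  have "u \<noteq> v" using pair_no_loops[OF assms(2)] by simp
  then show ?thesis by simp
qed

(* pre_digraph.cycle also admits the closed walk u, v, u along a single undirected edge,
   which is not a cycle of a simple graph; the length bound excludes it. *)
definition graph_cycle :: "'a pair_pre_digraph \<Rightarrow> ('a \<times> 'a) awalk \<Rightarrow> bool" where
  "graph_cycle G p \<longleftrightarrow> pre_digraph.cycle (with_proj G) p \<and> length p \<ge> 3"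

(* Unspecified if G has no cycle. *)
definition girth :: "'a pair_pre_digraph \<Rightarrow> nat" where
  "girth G = (LEAST k. \<exists>p. graph_cycle G p \<and> length p = k)"

definition cycle_graph :: "nat \<Rightarrow> nat pair_pre_digraph" where
  "cycle_graph n =
     (let A = {(i, (i + 1) mod n) | i. i < n}
      in \<lparr> pverts = {..<n}, parcs = A \<union> A\<inverse> \<rparr>)"

(* C_{n,g}: the cycle on 0, ..., g - 1, the path on the new vertices g, ..., n - 1, and the
   edge joining 0 to the end g of that path. *)
definition cycle_pendant_path :: "nat \<Rightarrow> nat \<Rightarrow> nat pair_pre_digraph" where
  "cycle_pendant_path n g =
     (let A = {(i, (i + 1) mod g) | i. i < g} \<union> {(0, g)} \<union> {(i, i + 1) | i. g \<le> i \<and> i + 1 < n}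
      in \<lparr> pverts = {..<n}, parcs = A \<union> A\<inverse> \<rparr>)"

lemma Suc_mod_neq: "n \<ge> 2 \<Longrightarrow> i < n \<Longrightarrow> Suc i mod n \<noteq> i" for i n :: nat
  by (cases "Suc i = n") auto

lemma pair_graph_symmetrised:
  assumes "A \<subseteq> {..<n::nat} \<times> {..<n}" "\<And>i. (i, i) \<notin> A"
  shows "pair_graph \<lparr> pverts = {..<n}, parcs = A \<union> A\<inverse> \<rparr>"
proof -
  have fin: "finite A" using assms(1) finite_subset by blast
  show ?thesis
    using assms fin by unfold_locales (auto simp: symmetric_def sym_def)
qed

lemma pair_graph_cycle_graph: "n \<ge> 3 \<Longrightarrow> pair_graph (cycle_graph n)"
  unfolding cycle_graph_def Let_def
  by (rule pair_graph_symmetrised) (auto simp: Suc_mod_neq dest: sym)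

lemma pair_graph_cycle_pendant_path:
  assumes "3 \<le> g" "g < n"
  shows "pair_graph (cycle_pendant_path n g)"
proof -
  have "Suc i mod g < n" for i
    using assms mod_less_divisor[of g "Suc i"] by linarith
  moreover have "i < g \<Longrightarrow> i \<noteq> Suc i mod g" for i
    using Suc_mod_neq[of g i] assms by auto
  ultimately show ?thesis
    unfolding cycle_pendant_path_def Let_def
    by (intro pair_graph_symmetrised) (use assms in auto)
qed

end

theory Submission
  imports Defs
begin

text \<open>Since \<open>a\<^sup>2 + b\<^sup>2 + a b \<ge> (3/4) (a + b)\<^sup>2\<close>, the index is at least \<open>\<surd>3/2\<close> times the sum of the
  squared degrees. Send each vertex of a shortest cycle to the next one and every other vertex to
  a neighbour nearer to that cycle; the map \<open>f\<close> so obtained has no two-cycles, so the pairs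
  \<open>{v, f v}\<close> are \<open>n\<close> distinct edges. If there is a further edge, or if there are at least two
  leaves, the bound by squared degrees gives \<open>EUS G \<ge> 2\<surd>3 (n + 1)\<close>, which exceeds all three
  claimed values. Otherwise \<open>f\<close> determines the graph, and its leaves are the vertices without
  \<open>f\<close>-preimage: without a leaf the graph is the cycle, and with a single leaf the orbit of that
  leaf runs through all vertices, which gives the cycle with a pendant path.\<close>

subsection \<open>The degree bound\<close>

lemma edges_conv_parcs: "edges G = (\<lambda>(u, v). {u, v}) ` parcs G"
  unfolding edges_def by force

text \<open>Every fibre of \<open>(u, v) \<mapsto> {u, v}\<close> over an edge is an arc together
  with its reverse, and these differ because there are no loops.\<close>

lemma sum_over_arcs:
  fixes h :: "'a set \<Rightarrow> real"
  assumes "pair_graph G"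
  shows "(\<Sum>(u, v)\<in>parcs G. h {u, v}) = 2 * (\<Sum>e\<in>edges G. h e)"
proof -
  interpret pair_graph G by fact
  let ?k = "\<lambda>(u, v). {u, v}"
  have "(\<Sum>p\<in>{p \<in> parcs G. ?k p = e}. h (?k p)) = 2 * h e" if e: "e \<in> edges G" for e
  proof -
    obtain u v where uv: "e = {u, v}" "(u, v) \<in> parcs G"
      using e unfolding edges_def by blast
    have ne: "(u, v) \<noteq> (v, u)"
      using no_loops'[OF uv(2)] by simp
    have fibre: "{p \<in> parcs G. ?k p = e} = {(u, v), (v, u)}"
    proof (rule set_eqI)
      fix p :: "'a \<times> 'a"
      obtain x y where "p = (x, y)" by (cases p)
      moreover have "{x, y} = {u, v} \<longleftrightarrow> x = u \<and> y = v \<or> x = v \<and> y = u"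
        by (rule doubleton_eq_iff)
      ultimately show "p \<in> {p \<in> parcs G. ?k p = e} \<longleftrightarrow> p \<in> {(u, v), (v, u)}"
        using uv(2) arcs_symmetric[OF uv(2)] unfolding uv(1) by force
    qed
    have "h (?k (u, v)) = h e" "h (?k (v, u)) = h e"
      using uv(1) by (simp_all add: insert_commute)
    then show ?thesis
      unfolding fibre using ne by (subst sum.insert) simp_all
  qed
  then have "(\<Sum>e\<in>edges G. \<Sum>p\<in>{p \<in> parcs G. ?k p = e}. h (?k p)) = (\<Sum>e\<in>edges G. 2 * h e)"
    by (rule sum.cong[OF refl])
  then have "(\<Sum>p\<in>parcs G. h (?k p)) = (\<Sum>e\<in>edges G. 2 * h e)"
    unfolding edges_conv_parcs by (rule trans[OF sum.image_gen[OF pair_finite_arcs]])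
  then show ?thesis by (simp add: sum_distrib_left case_prod_beta')
qed

definition edge_weight :: "nat \<Rightarrow> nat \<Rightarrow> real" where
  "edge_weight a b = sqrt (real a ^ 2 + real b ^ 2 + real a * real b)"

text \<open>The squares differ by exactly \<open>(a - b)^2 / 4\<close>, so the bound is sharp for
  equal degrees.\<close>

lemma edge_weight_ge: "edge_weight a b \<ge> sqrt 3 / 2 * (real a + real b)"
proof -
  have "0 \<le> (real a - real b)\<^sup>2" by simp
  then have "(sqrt 3 / 2 * (real a + real b))\<^sup>2 \<le> real a ^ 2 + real b ^ 2 + real a * real b"
    by (simp add: power_mult_distrib power_divide power2_sum power2_diff field_simps)
  then show ?thesis unfolding edge_weight_def by (rule real_le_rsqrt)
qed

lemma out_degree_with_proj: "out_degree (with_proj G) v = card {w. (v, w) \<in> parcs G}"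
proof -
  have "out_arcs (with_proj G) v = Pair v ` {w. (v, w) \<in> parcs G}"
    unfolding out_arcs_def by force
  then show ?thesis
    unfolding out_degree_def by (simp add: card_image inj_on_def)
qed

lemma sum_arcs_tail:
  fixes h :: "'a \<Rightarrow> 'b :: comm_semiring_1"
  assumes "pair_fin_digraph G"
  shows "(\<Sum>(u, v)\<in>parcs G. h u) = (\<Sum>u\<in>pverts G. of_nat (out_degree (with_proj G) u) * h u)"
proof -
  interpret pair_fin_digraph G by fact
  have eq: "parcs G = Sigma (pverts G) (\<lambda>u. {w. (u, w) \<in> parcs G})"
    using wellformed' by auto
  have "finite {w. (u, w) \<in> parcs G}" for u
    by (rule finite_subset[OF _ pair_finite_verts]) (auto dest: wellformed')
  then have "(\<Sum>(u, v)\<in>parcs G. h u) = (\<Sum>u\<in>pverts G. \<Sum>v | (u, v) \<in> parcs G. h u)"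
    by (subst eq) (subst sum.Sigma, auto simp: pair_finite_verts)
  then show ?thesis by (simp add: out_degree_with_proj)
qed

text \<open>When \<open>edge_weight_ge\<close> is summed over all arcs, a vertex of degree
  \<open>d\<close> occurs \<open>d\<close> times as a tail and \<open>d\<close> times as a head,
  contributing \<open>d\<close> each time.\<close>

lemma EUS_ge_degree_squares:
  assumes "pair_graph G"
  shows "EUS G \<ge> sqrt 3 / 2 * (\<Sum>v\<in>pverts G. real (out_degree (with_proj G) v) ^ 2)"
proof -
  interpret pair_graph G by fact
  let ?d = "out_degree (with_proj G)"
  let ?h = "\<lambda>e. sqrt ((\<Sum>v\<in>e. real (?d v) ^ 2) + (\<Prod>v\<in>e. real (?d v)))"
  have swap: "prod.swap ` parcs G = parcs G"
    using arcs_symmetric by force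
  have tails: "(\<Sum>(u, v)\<in>parcs G. real (?d u)) = (\<Sum>v\<in>pverts G. real (?d v) ^ 2)"
    using sum_arcs_tail[OF pair_fin_digraph, of "\<lambda>u. real (?d u)"] by (simp add: power2_eq_square)
  have heads: "(\<Sum>(u, v)\<in>parcs G. real (?d v)) = (\<Sum>(u, v)\<in>parcs G. real (?d u))"
    using sum.reindex[of prod.swap "parcs G" "\<lambda>(u, v). real (?d u)"] swap
    by (simp add: case_prod_beta)
  have "2 * EUS G = (\<Sum>(u, v)\<in>parcs G. ?h {u, v})"
    unfolding EUS_def by (rule sum_over_arcs[OF assms, symmetric])
  also have "\<dots> = (\<Sum>(u, v)\<in>parcs G. edge_weight (?d u) (?d v))"
  proof (rule sum.cong[OF refl])
    fix p assume "p \<in> parcs G"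
    then have "?h {fst p, snd p} = edge_weight (?d (fst p)) (?d (snd p))"
      unfolding edge_weight_def by (intro EUS_summand[OF assms]) simp
    then show "(case p of (u, v) \<Rightarrow> ?h {u, v}) = (case p of (u, v) \<Rightarrow> edge_weight (?d u) (?d v))"
      by (simp only: case_prod_beta)
  qed
  also have "\<dots> \<ge> (\<Sum>(u, v)\<in>parcs G. sqrt 3 / 2 * (real (?d u) + real (?d v)))"
    by (intro sum_mono) (simp only: case_prod_beta edge_weight_ge)
  also have "(\<Sum>(u, v)\<in>parcs G. sqrt 3 / 2 * (real (?d u) + real (?d v)))
      = sqrt 3 / 2 * ((\<Sum>(u, v)\<in>parcs G. real (?d u)) + (\<Sum>(u, v)\<in>parcs G. real (?d v)))"
    by (simp only: sum.distrib[symmetric] sum_distrib_left case_prod_beta')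
  finally show ?thesis using heads tails by (simp add: algebra_simps)
qed

text \<open>At integers \<open>d\<close> the parabola \<open>d^2\<close> lies on or above its chord
  \<open>5 * d - 6\<close> through 2 and 3. At \<open>d = 1\<close> the gap is 2, which yields the
  leaf term. The degrees add up to the number of arcs.\<close>

lemma EUS_ge_arcs_leaves:
  assumes "pair_graph G"
    and "\<And>v. v \<in> pverts G \<Longrightarrow> out_degree (with_proj G) v \<ge> 1"
  shows "EUS G \<ge> sqrt 3 / 2 * (5 * real (card (parcs G)) - 6 * real (card (pverts G))
           + 2 * real (card {v \<in> pverts G. out_degree (with_proj G) v = 1}))"
proof -
  interpret pair_graph G by fact
  let ?d = "out_degree (with_proj G)"
  \<comment> \<open>equality holds for the degrees 1, 2 and 3\<close>
  have pt: "5 * real a - 6 + 2 * (if a = 1 then 1 else 0) \<le> real a ^ 2" if "a \<ge> 1" for a :: nat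
  proof -
    have "0 \<le> (real a - 2) * (real a - 3)"
    proof (cases "a \<le> 2")
      case True
      then show ?thesis by (intro mult_nonpos_nonpos) auto
    qed auto
    then show ?thesis by (auto simp: power2_eq_square algebra_simps)
  qed
  have arcs: "real (card (parcs G)) = (\<Sum>v\<in>pverts G. real (?d v))"
    using sum_arcs_tail[OF pair_fin_digraph, of "\<lambda>_. 1 :: real"] by (simp add: case_prod_beta)
  have "real (card {v \<in> pverts G. ?d v = 1}) = (\<Sum>v\<in>pverts G. if ?d v = 1 then 1 else 0)"
    using pair_finite_verts by (simp add: sum.If_cases Int_def)
  then have "5 * real (card (parcs G)) - 6 * real (card (pverts G))
        + 2 * real (card {v \<in> pverts G. ?d v = 1})
      = (\<Sum>v\<in>pverts G. 5 * real (?d v) - 6 + 2 * (if ?d v = 1 then 1 else 0))"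
    unfolding arcs by (simp add: sum.distrib sum_subtractf sum_distrib_left)
  also have "\<dots> \<le> (\<Sum>v\<in>pverts G. real (?d v) ^ 2)"
    using pt assms(2) by (intro sum_mono) blast
  finally have "sqrt 3 / 2 * (5 * real (card (parcs G)) - 6 * real (card (pverts G))
        + 2 * real (card {v \<in> pverts G. ?d v = 1}))
      \<le> sqrt 3 / 2 * (\<Sum>v\<in>pverts G. real (?d v) ^ 2)"
    by (intro mult_left_mono) auto
  then show ?thesis using EUS_ge_degree_squares[OF assms(1)] by linarith
qed

section \<open>Invariance of the index under isomorphism\<close>

lemma EUS_digraph_iso:
  assumes "pair_graph G" "pair_graph H" "digraph_iso (with_proj G) (with_proj H)"
  shows "EUS G = EUS H"
proof -
  interpret G: pair_graph G by fact
  interpret H: pair_graph H by fact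
  obtain hom where hom: "G.digraph_isomorphism hom" and H: "with_proj H = app_iso hom (with_proj G)"
    using assms(3) unfolding digraph_iso_def by blast
  define \<phi> where "\<phi> = iso_verts hom"
  have inj: "inj_on \<phi> (pverts G)"
    using G.digraph_isomorphism_inj_on_verts[OF hom] by (simp add: \<phi>_def)
  \<comment> \<open>The arc part of an isomorphism is separate data; since heads and tails in
    \<open>with_proj H\<close> are the projections of pairs, the vertex map determines it.\<close>
  have "iso_arcs hom (u, v) = (\<phi> u, \<phi> v)" if "(u, v) \<in> parcs G" for u v
    using G.iso_verts_tail[OF hom that] G.iso_verts_head[OF hom that] arg_cong[OF H, of tail]
      arg_cong[OF H, of head] by (simp add: \<phi>_def prod_eq_iff)
  then have "parcs H = (\<lambda>(u, v). (\<phi> u, \<phi> v)) ` parcs G"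
    using arg_cong[OF H, of arcs] by (auto simp: image_iff) (metis case_prod_conv)+
  then have edges: "edges H = (`) \<phi> ` edges G"
    by (simp add: edges_conv_parcs image_image case_prod_beta)
  have sub: "e \<subseteq> pverts G" if "e \<in> edges G" for e
    using that G.wellformed' unfolding edges_def by blast
  have inj_edges: "inj_on ((`) \<phi>) (edges G)"
    using sub inj by (meson inj_onI inj_on_image_eq_iff)
  have deg: "out_degree (with_proj H) (\<phi> v) = out_degree (with_proj G) v" if "v \<in> pverts G" for v
    unfolding H \<phi>_def using G.out_degree_app_iso_eq[OF hom] that by simp
  have sums: "(\<Sum>v\<in>\<phi> ` e. real (out_degree (with_proj H) v) ^ 2) = (\<Sum>v\<in>e. real (out_degree (with_proj G) v) ^ 2)"
    and prods: "(\<Prod>v\<in>\<phi> ` e. real (out_degree (with_proj H) v)) = (\<Prod>v\<in>e. real (out_degree (with_proj G) v))"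
    if "e \<in> edges G" for e
    unfolding sum.reindex[OF inj_on_subset[OF inj sub[OF that]]]
      prod.reindex[OF inj_on_subset[OF inj sub[OF that]]] comp_def
    using sub[OF that] deg by (simp_all add: subset_iff)
  show ?thesis
    unfolding EUS_def edges sum.reindex[OF inj_edges] by (simp add: sums prods)
qed

subsection \<open>Graphs of maps without two-cycles\<close>

definition functional_graph :: "'a set \<Rightarrow> ('a \<Rightarrow> 'a) \<Rightarrow> 'a pair_pre_digraph" where
  "functional_graph V f =
     \<lparr> pverts = V, parcs = (\<lambda>v. (v, f v)) ` V \<union> ((\<lambda>v. (v, f v)) ` V)\<inverse> \<rparr>"

text \<open>Excluding \<open>f (f v) = v\<close> also excludes fixed points, and it makes the pairs
  \<open>{v, f v}\<close> distinct for distinct \<open>v\<close>: two coinciding pairs would form a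
  two-cycle.\<close>

locale functional_digraph =
  fixes V :: "'a set" and f :: "'a \<Rightarrow> 'a"
  assumes finite: "finite V"
    and closed: "v \<in> V \<Longrightarrow> f v \<in> V"
    and no_two_cycle: "v \<in> V \<Longrightarrow> f (f v) \<noteq> v"
begin

lemma no_fixpoint: "v \<in> V \<Longrightarrow> f v \<noteq> v"
  using no_two_cycle by metis

lemma parcs_iff:
  "(u, v) \<in> parcs (functional_graph V f) \<longleftrightarrow> u \<in> V \<and> v = f u \<or> v \<in> V \<and> u = f v"
  unfolding functional_graph_def by auto

lemma pair_graph_functional_graph: "pair_graph (functional_graph V f)"
  using finite closed no_fixpoint no_fixpoint[symmetric]
  by unfold_locales (auto simp: functional_graph_def symmetric_def sym_def)

text \<open>The neighbours of \<open>v\<close> are its preimages and \<open>f v\<close>, and the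
  latter is not a preimage because there are no two-cycles.\<close>

lemma out_degree_functional_graph:
  assumes "v \<in> V"
  shows "out_degree (with_proj (functional_graph V f)) v = Suc (card {u \<in> V. f u = v})"
proof -
  have "{w. (v, w) \<in> parcs (functional_graph V f)} = insert (f v) {u \<in> V. f u = v}"
    using assms by (auto simp: parcs_iff)
  then show ?thesis
    using finite no_two_cycle[OF assms] by (simp add: out_degree_with_proj)
qed

lemma card_parcs_functional_graph: "card (parcs (functional_graph V f)) = 2 * card V"
proof -
  let ?A = "(\<lambda>v. (v, f v)) ` V"
  \<comment> \<open>A common arc \<open>(v, f v) = (f w, w)\<close> would give
    \<open>f (f w) = w\<close>.\<close>
  have "?A \<inter> ?A\<inverse> = {}" using no_two_cycle[symmetric] by auto
  moreover have "card ?A = card V" by (auto intro!: card_image inj_onI)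
  ultimately show ?thesis
    using finite by (simp add: functional_graph_def card_Un_disjoint)
qed

text \<open>Each edge is \<open>{v, f v}\<close> for exactly one \<open>v\<close>, so the index is a
  sum over vertices. The parameter \<open>d\<close> lets explicit degree formulas be
  substituted.\<close>

lemma EUS_functional_graph:
  assumes "\<And>v. v \<in> V \<Longrightarrow> d v = out_degree (with_proj (functional_graph V f)) v"
  shows "EUS (functional_graph V f) = (\<Sum>v\<in>V. edge_weight (d v) (d (f v)))"
proof -
  let ?G = "functional_graph V f"
  have "edges ?G = (\<lambda>v. {v, f v}) ` V"
  proof (rule set_eqI)
    fix e
    have "e \<in> edges ?G \<longleftrightarrow> (\<exists>u v. e = {u, v} \<and> (u \<in> V \<and> v = f u \<or> v \<in> V \<and> u = f v))"
      unfolding edges_def by (simp add: parcs_iff)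
    also have "\<dots> \<longleftrightarrow> (\<exists>v\<in>V. e = {v, f v})"
      using insert_commute by metis
    finally show "e \<in> edges ?G \<longleftrightarrow> e \<in> (\<lambda>v. {v, f v}) ` V"
      by (simp add: image_iff)
  qed
  moreover have "inj_on (\<lambda>v. {v, f v}) V"
    using no_two_cycle by (metis (mono_tags, lifting) doubleton_eq_iff inj_onI)
  moreover have "sqrt ((\<Sum>x\<in>{v, f v}. real (out_degree (with_proj ?G) x) ^ 2)
      + (\<Prod>x\<in>{v, f v}. real (out_degree (with_proj ?G) x))) = edge_weight (d v) (d (f v))"
    if "v \<in> V" for v
    unfolding edge_weight_def assms[OF that] assms[OF closed[OF that]]
    by (rule EUS_summand[OF pair_graph_functional_graph]) (simp add: parcs_iff that)
  ultimately show ?thesis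
    unfolding EUS_def by (simp only: sum.reindex comp_def cong: sum.cong)
qed

text \<open>A bijection conjugating \<open>f\<close> to \<open>h\<close> carries the arcs
  \<open>(v, f v)\<close> onto the arcs \<open>(w, h w)\<close>, and this is compatible with
  reversing arcs.\<close>

lemma digraph_iso_functional_graph:
  assumes "bij_betw \<phi> V W" "\<And>v. v \<in> V \<Longrightarrow> \<phi> (f v) = h (\<phi> v)"
  shows "digraph_iso (with_proj (functional_graph V f)) (with_proj (functional_graph W h))"
proof -
  interpret pair_graph "functional_graph V f" by (rule pair_graph_functional_graph)
  let ?hom = "\<lparr> iso_verts = \<phi>, iso_arcs = map_prod \<phi> \<phi>, iso_head = snd, iso_tail = fst \<rparr>"
  have inj: "inj_on \<phi> V" and img: "\<phi> ` V = W"
    using assms(1) by (auto simp: bij_betw_def)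
  have V: "pverts (functional_graph V f) = V"
    by (simp add: functional_graph_def)
  have sub: "parcs (functional_graph V f) \<subseteq> V \<times> V"
    using wellformed' V by auto
  have "digraph_isomorphism ?hom"
    unfolding digraph_isomorphism_def
    using inj V inj_on_subset[OF map_prod_inj_on[OF inj inj] sub] wf_digraph_axioms by simp
  moreover have "with_proj (functional_graph W h) = app_iso ?hom (with_proj (functional_graph V f))"
  proof (rule pre_digraph.equality)
    have "map_prod \<phi> \<phi> ` ((\<lambda>v. (v, f v)) ` V) = (\<lambda>v. (v, h v)) ` W"
      unfolding img[symmetric] image_image using assms(2) by (intro image_cong) auto
    moreover have "map_prod \<phi> \<phi> ` (A\<inverse>) = (map_prod \<phi> \<phi> ` A)\<inverse>" for A
      by force
    ultimately show "arcs (with_proj (functional_graph W h))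
        = arcs (app_iso ?hom (with_proj (functional_graph V f)))"
      by (simp add: functional_graph_def image_Un)
  qed (use img V in \<open>auto simp: functional_graph_def\<close>)
  ultimately show ?thesis unfolding digraph_iso_def by blast
qed

end

text \<open>The successor map that orients the cycle of \<^term>\<open>cycle_pendant_path n g\<close> cyclically and
  its path towards the cycle.\<close>

definition lasso_next :: "nat \<Rightarrow> nat \<Rightarrow> nat" where
  "lasso_next g i = (if i < g then Suc i mod g else if i = g then 0 else i - 1)"

lemma lasso_next_simps:
  "Suc i < g \<Longrightarrow> lasso_next g i = Suc i"
  "0 < g \<Longrightarrow> lasso_next g (g - 1) = 0"
  "lasso_next g g = 0"
  "g < i \<Longrightarrow> lasso_next g i = i - 1"
  by (auto simp: lasso_next_def)

text \<open>With \<open>g = n\<close> every vertex \<open>i < n\<close> falls in the first branch of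
  \<open>lasso_next\<close>.\<close>

lemma cycle_graph_eq_functional_graph: "cycle_graph n = functional_graph {..<n} (lasso_next n)"
proof -
  have "{(i, (i + 1) mod n) | i. i < n} = (\<lambda>i. (i, lasso_next n i)) ` {..<n}"
    by (auto simp: lasso_next_def image_iff)
  then show ?thesis by (simp only: cycle_graph_def functional_graph_def Let_def)
qed

lemma cycle_pendant_path_eq_functional_graph:
  assumes "g < n"
  shows "cycle_pendant_path n g = functional_graph {..<n} (lasso_next g)"
proof -
  let ?C = "{(i, (i + 1) mod g) | i. i < g}" and ?P = "{(i, i + 1) | i. g \<le> i \<and> i + 1 < n}"
  have "{..<n} = {..<g} \<union> {g} \<union> Suc ` {g..<n - 1}"
  proof (rule set_eqI)
    fix i
    show "i \<in> {..<n} \<longleftrightarrow> i \<in> {..<g} \<union> {g} \<union> Suc ` {g..<n - 1}"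
      using assms by (cases i) auto
  qed
  then have "(\<lambda>i. (i, lasso_next g i)) ` {..<n} = (\<lambda>i. (i, lasso_next g i)) ` {..<g}
      \<union> {(g, lasso_next g g)} \<union> (\<lambda>i. (Suc i, lasso_next g (Suc i))) ` {g..<n - 1}"
    by (simp only: image_Un image_image image_insert image_empty)
  also have "(\<lambda>i. (i, lasso_next g i)) ` {..<g} = ?C"
    by (auto simp: lasso_next_def image_iff)
  \<comment> \<open>The path arcs come out reversed, since \<open>lasso_next\<close> runs towards
    the cycle; the symmetrisation absorbs this, as it does for the arc from \<open>g\<close> to
    0.\<close>
  also have "(\<lambda>i. (Suc i, lasso_next g (Suc i))) ` {g..<n - 1} = ?P\<inverse>"
    by (auto simp: lasso_next_def image_iff)
  finally show ?thesis
    by (auto simp: cycle_pendant_path_def functional_graph_def Let_def lasso_next_def)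
qed

lemma functional_digraph_lasso:
  assumes "3 \<le> g" "g \<le> n"
  shows "functional_digraph {..<n} (lasso_next g)"
proof
  fix i assume i: "i \<in> {..<n}"
  have "Suc i mod g < n"
    by (rule less_le_trans[OF mod_less_divisor assms(2)]) (use assms in simp)
  then show "lasso_next g i \<in> {..<n}"
    using assms i unfolding lasso_next_def by auto
  \<comment> \<open>The cases separate the places where two steps wrap around or enter the cycle:
    \<open>g - 2\<close> and \<open>Suc g\<close> end at 0, \<open>g - 1\<close> and
    \<open>g\<close> end at 1. As \<open>g\<close> is at least 3, none returns to its start.\<close>
  consider "i < g - 2" | "i = g - 2" | "i = g - 1" | "i = g" | "i = Suc g" | "i > Suc g"
    by linarith
  then show "lasso_next g (lasso_next g i) \<noteq> i"
    using assms by cases (auto simp: lasso_next_def mod_Suc)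
qed auto

section \<open>The index of the extremal graphs\<close>

lemma edge_weight_2_2: "edge_weight 2 2 = 2 * sqrt 3"
  using real_sqrt_mult[of 4 3] by (simp add: edge_weight_def)

lemma EUS_cycle_graph:
  assumes "3 \<le> n"
  shows "EUS (cycle_graph n) = 2 * sqrt 3 * real n"
proof -
  interpret functional_digraph "{..<n}" "lasso_next n"
    using assms by (intro functional_digraph_lasso) auto
  \<comment> \<open>The cyclic predecessor is the only preimage, so every degree is 2.\<close>
  have "{u \<in> {..<n}. lasso_next n u = i} = {if i = 0 then n - 1 else i - 1}" if "i < n" for i
    using that assms by (auto simp: lasso_next_def mod_Suc)
  then have "2 = out_degree (with_proj (functional_graph {..<n} (lasso_next n))) i"
    if "i \<in> {..<n}" for i
    using that out_degree_functional_graph[OF that] by simp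
  then show ?thesis
    using EUS_functional_graph[of "\<lambda>_. 2"]
    by (simp add: cycle_graph_eq_functional_graph edge_weight_2_2)
qed

lemma EUS_cycle_pendant_path_sum:
  assumes "3 \<le> g" "g < n"
  defines "d \<equiv> \<lambda>i. if i = 0 then 3 else if i = n - 1 then 1 else (2 :: nat)"
  shows "EUS (cycle_pendant_path n g) = (\<Sum>i<n. edge_weight (d i) (d (lasso_next g i)))"
proof -
  interpret functional_digraph "{..<n}" "lasso_next g"
    using assms by (intro functional_digraph_lasso) auto
  \<comment> \<open>Vertex 0 has two preimages, the path end \<open>n - 1\<close> has none, and
    every other vertex has one; adding one gives the degrees in \<open>d\<close>.\<close>
  have "{u \<in> {..<n}. lasso_next g u = i} =
      (if i = 0 then {g - 1, g} else if i < g then {i - 1} else if i = n - 1 then {} else {Suc i})"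
    if "i < n" for i
    using that assms by (auto simp: lasso_next_def mod_Suc split: if_splits)
  then have "d i = out_degree (with_proj (functional_graph {..<n} (lasso_next g))) i"
    if "i \<in> {..<n}" for i
    using that assms out_degree_functional_graph[OF that] by (auto simp: d_def)
  then show ?thesis
    unfolding cycle_pendant_path_eq_functional_graph[OF assms(2)]
    by (rule EUS_functional_graph)
qed

lemma EUS_cycle_pendant_path:
  assumes "3 \<le> g" "g < n"
  shows "EUS (cycle_pendant_path n g) =
    (if g = n - 1 then 2 * sqrt 3 * (real n - 3) + 2 * sqrt 19 + sqrt 13
     else 3 * sqrt 19 + 2 * (real n - 4) * sqrt 3 + sqrt 7)"
proof -
  define d :: "nat \<Rightarrow> nat" where "d i = (if i = 0 then 3 else if i = n - 1 then 1 else 2)" for i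
  define w where "w i = edge_weight (d i) (d (lasso_next g i))" for i
  have EUS: "EUS (cycle_pendant_path n g) = sum w {..<n}"
    unfolding w_def d_def by (rule EUS_cycle_pendant_path_sum[OF assms])
  \<comment> \<open>These are the vertices \<open>i\<close> whose edge to
    \<open>lasso_next g i\<close> meets the branch vertex 0 or the leaf \<open>n - 1\<close>; all
    other edges join two vertices of degree 2.\<close>
  define S where "S = {0, g - 1, g, n - 1}"
  have "d i = 2 \<and> d (lasso_next g i) = 2" if "i \<in> {..<n} - S" for i
    using that assms by (auto simp: S_def d_def lasso_next_def mod_Suc)
  then have "sum w ({..<n} - S) = (\<Sum>i\<in>{..<n} - S. 2 * sqrt 3)"
    by (intro sum.cong) (auto simp: w_def edge_weight_2_2)
  moreover have S: "S \<subseteq> {..<n}" using assms by (auto simp: S_def)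
  moreover have "finite S" by (simp add: S_def)
  ultimately have sum: "EUS (cycle_pendant_path n g) = (real n - real (card S)) * (2 * sqrt 3) + sum w S"
    using card_mono[of "{..<n}" S] unfolding EUS
    by (subst sum.subset_diff[of S]) (auto simp: card_Diff_subset of_nat_diff)
  have "lasso_next g 0 = 1" "lasso_next g (g - 1) = 0"
    using assms by (simp_all add: lasso_next_simps(1) lasso_next_simps(2)[simplified])
  moreover have "d 0 = 3" "d 1 = 2" "d (g - 1) = 2"
    using assms by (auto simp: d_def)
  ultimately have w0: "w 0 = sqrt 19" and w1: "w (g - 1) = sqrt 19"
    by (simp_all add: w_def edge_weight_def)
  show ?thesis
  proof (cases "g = n - 1")
    case True
    \<comment> \<open>The path is a single vertex, so its attaching edge is also the leaf edge, with
      end degrees 1 and 3.\<close>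
    then have S: "S = {0, g - 1, g}" by (auto simp: S_def)
    have wg: "w g = sqrt 13"
      using True assms by (simp add: w_def d_def lasso_next_def edge_weight_def)
    have "card S = 3" "sum w S = 2 * sqrt 19 + sqrt 13"
      unfolding S using assms by (auto simp: w0 w1[simplified] wg)
    then show ?thesis using sum True by (simp add: algebra_simps)
  next
    case False
    \<comment> \<open>The attaching edge now has end degrees 2 and 3, the leaf edge 1 and 2.\<close>
    have wg: "w g = sqrt 19" and wn: "w (n - 1) = sqrt 7"
      using False assms by (auto simp: w_def d_def lasso_next_def edge_weight_def)
    have "0 \<notin> {g - 1, g, n - 1}" "g - 1 \<notin> {g, n - 1}" "g \<noteq> n - 1"
      using assms False by auto
    then have "card S = 4" "sum w S = 3 * sqrt 19 + sqrt 7"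
      unfolding S_def by (auto simp: w0 w1[simplified] wg wn[simplified])
    then show ?thesis using sum False by (simp add: algebra_simps)
  qed
qed

subsection \<open>Maps attracted by a cycle\<close>

text \<open>The rank \<open>\<mu>\<close> stands in for the distance to the cycle \<open>S\<close>.
  The orbit condition is stated for every \<open>s\<close>, so that the cycle can be numbered from
  the vertex where a tail enters it.\<close>

locale attracting_cycle = functional_digraph V f for V :: "'a set" and f +
  fixes S :: "'a set" and g :: nat and \<mu> :: "'a \<Rightarrow> nat"
  assumes cycle_subset: "S \<subseteq> V"
    and card_cycle: "card S = g"
    and cycle_length: "3 \<le> g"
    and cycle_orbit: "s \<in> S \<Longrightarrow> S = (\<lambda>i. (f ^^ i) s) ` {..<g}"
    and cycle_return: "s \<in> S \<Longrightarrow> (f ^^ g) s = s"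
    and distance_decreasing: "v \<in> V - S \<Longrightarrow> \<mu> (f v) < \<mu> v"
begin

lemma cycle_closed:
  assumes "s \<in> S" shows "f s \<in> S"
proof -
  have "f s = (f ^^ 1) s" by simp
  then show ?thesis using cycle_orbit[OF assms] cycle_length by (metis image_eqI lessThan_iff
        less_le_trans one_less_numeral_iff semiring_norm(77))
qed

lemma cycle_has_preimage:
  assumes "s \<in> S" shows "\<exists>u\<in>S. f u = s"
proof
  have "f ((f ^^ (g - 1)) s) = (f ^^ Suc (g - 1)) s" by simp
  then show "f ((f ^^ (g - 1)) s) = s"
    using cycle_return[OF assms] cycle_length by simp
  show "(f ^^ (g - 1)) s \<in> S"
    by (subst cycle_orbit[OF assms]) (use cycle_length in auto)
qed

text \<open>A vertex outside \<^term>\<open>W\<close> at maximal distance from \<^term>\<open>S\<close> would have a preimage further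
  away, which again lies outside \<^term>\<open>W\<close>.\<close>

lemma closed_superset_eq:
  assumes "S \<subseteq> W" "W \<subseteq> V" "\<And>v. v \<in> W \<Longrightarrow> f v \<in> W" "\<And>v. v \<in> V - W \<Longrightarrow> \<exists>u\<in>V. f u = v"
  shows "W = V"
proof (rule ccontr)
  assume "W \<noteq> V"
  then have "V - W \<noteq> {}" using assms(2) by blast
  then have "Max (\<mu> ` (V - W)) \<in> \<mu> ` (V - W)"
    using finite by (intro Max_in) auto
  then obtain v where v: "v \<in> V - W" "\<mu> v = Max (\<mu> ` (V - W))" by auto
  obtain u where u: "u \<in> V" "f u = v" using assms(4)[OF v(1)] by blast
  then have uW: "u \<in> V - W" using assms(3) v(1) by blast
  then have "\<mu> u \<le> \<mu> v" unfolding v(2) using finite by (intro Max_ge) auto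
  moreover have "\<mu> v < \<mu> u" using distance_decreasing[of u] uW u(2) assms(1) by blast
  ultimately show False by simp
qed

text \<open>Outside \<open>S\<close> each step lowers \<open>\<mu>\<close>, so no orbit can stay
  there.\<close>

lemma reaches_cycle: "v \<in> V \<Longrightarrow> \<exists>t. (f ^^ t) v \<in> S"
proof (induction "\<mu> v" arbitrary: v rule: less_induct)
  case less
  show ?case
  proof (cases "v \<in> S")
    case True
    then show ?thesis by (intro exI[of _ 0]) simp
  next
    case False
    then obtain t where "(f ^^ t) (f v) \<in> S"
      using less distance_decreasing[of v] closed[of v] by blast
    then have "(f ^^ Suc t) v \<in> S" by (simp add: funpow_swap1)
    then show ?thesis by blast
  qed
qed

lemma funpow_closed: "v \<in> V \<Longrightarrow> (f ^^ i) v \<in> V"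
  by (induction i) (auto simp: closed)

text \<open>The \<open>g\<close> indices cover the \<open>g\<close> elements of \<open>S\<close>,
  which leaves no room for repetition.\<close>

lemma cycle_orbit_inj:
  assumes "s \<in> S" shows "inj_on (\<lambda>i. (f ^^ i) s) {..<g}"
  using card_cycle by (intro eq_card_imp_inj_on) (simp_all flip: cycle_orbit[OF assms])

text \<open>The numbering \<open>\<phi>\<close> conjugates \<open>lasso_next g\<close> to
  \<open>f\<close>, so it is an isomorphism from the standard graph, which is then inverted.\<close>

lemma iso_lassoI:
  assumes "g \<le> n" "bij_betw \<phi> {..<n} V" "\<And>i. i < n \<Longrightarrow> f (\<phi> i) = \<phi> (lasso_next g i)"
  shows "digraph_iso (with_proj (functional_graph V f))
           (with_proj (functional_graph {..<n} (lasso_next g)))"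
proof -
  interpret L: functional_digraph "{..<n}" "lasso_next g"
    using cycle_length assms(1) by (rule functional_digraph_lasso)
  interpret pair_graph "functional_graph {..<n} (lasso_next g)"
    by (rule L.pair_graph_functional_graph)
  show ?thesis
    using assms(2,3)
    by (intro digraph_iso_swap[OF wf_digraph_axioms] L.digraph_iso_functional_graph) auto
qed

text \<open>\<open>S\<close> is closed under \<open>f\<close>, so \<open>closed_superset_eq\<close>
  with \<open>W = S\<close> leaves nothing outside the cycle.\<close>

lemma iso_cycle_graph:
  assumes "\<And>v. v \<in> V \<Longrightarrow> \<exists>u\<in>V. f u = v"
  shows "card V = g" "digraph_iso (with_proj (functional_graph V f)) (with_proj (cycle_graph g))"
proof -
  have SV: "S = V"
    using cycle_subset assms cycle_closed by (intro closed_superset_eq) auto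
  then show "card V = g" using card_cycle by simp
  obtain s where s: "s \<in> S" using card_cycle cycle_length by fastforce
  have "f ((f ^^ i) s) = (f ^^ lasso_next g i) s" if i: "i < g" for i
  proof (cases "Suc i = g")
    case True
    then have "f ((f ^^ i) s) = (f ^^ g) s" by auto
    then show ?thesis using True cycle_return[OF s] by (simp add: lasso_next_def)
  next
    case False
    then show ?thesis using i by (simp add: lasso_next_simps(1))
  qed
  then show "digraph_iso (with_proj (functional_graph V f)) (with_proj (cycle_graph g))"
    unfolding cycle_graph_eq_functional_graph
    using SV cycle_orbit[OF s] cycle_orbit_inj[OF s]
    by (intro iso_lassoI[where \<phi> = "\<lambda>i. (f ^^ i) s"]) (simp_all add: bij_betw_def)
qed

text \<open>The orbit of \<open>b\<close> up to its entry into \<open>S\<close>, together with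
  \<open>S\<close>, is closed under \<open>f\<close> and contains the only vertex without a
  preimage; by \<open>closed_superset_eq\<close> it is all of \<open>V\<close>.\<close>

lemma iso_cycle_pendant_path:
  assumes b: "b \<in> V" "\<And>u. u \<in> V \<Longrightarrow> f u \<noteq> b"
    and preimage: "\<And>v. v \<in> V \<Longrightarrow> v \<noteq> b \<Longrightarrow> \<exists>u\<in>V. f u = v"
  shows "g < card V"
    "digraph_iso (with_proj (functional_graph V f)) (with_proj (cycle_pendant_path (card V) g))"
proof -
  \<comment> \<open>\<open>t\<close> is the time at which the orbit of \<open>b\<close> enters the
    cycle, and \<open>s\<close> below is the vertex of entry.\<close>
  define t where "t = (LEAST t. (f ^^ t) b \<in> S)"
  define s where "s = (f ^^ t) b"
  have s: "s \<in> S"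
    unfolding s_def t_def using reaches_cycle[OF b(1)] by (rule LeastI_ex)
  have outside: "(f ^^ i) b \<notin> S" if "i < t" for i
    using not_less_Least that unfolding t_def by blast
  have "b \<notin> S" using b(2) cycle_has_preimage cycle_subset by blast
  then have "t \<noteq> 0" using s unfolding s_def by (auto intro: ccontr)
  \<comment> \<open>Strict decrease of \<open>\<mu>\<close> along the tail rules out repeated
    vertices.\<close>
  have decr: "\<mu> ((f ^^ j) b) < \<mu> ((f ^^ i) b)" if "i < j" "j < t" for i j
    using that
  proof (induction j rule: less_Suc_induct)
    case (1 i)
    then show ?case
      using distance_decreasing[of "(f ^^ i) b"] outside[of i] funpow_closed[OF b(1)] by auto
  qed auto
  have inj_tail: "inj_on (\<lambda>i. (f ^^ i) b) {..<t}"
    using decr by (intro inj_onI) (metis lessThan_iff less_irrefl linorder_neqE_nat)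
  let ?T = "(\<lambda>i. (f ^^ i) b) ` {..<t}"
  have "f v \<in> ?T \<union> S" if v: "v \<in> ?T \<union> S" for v
  proof (cases "v \<in> S")
    case True
    then show ?thesis using cycle_closed by blast
  next
    case False
    then obtain i where i: "i < t" "v = (f ^^ i) b" using v by auto
    then have fv: "f v = (f ^^ Suc i) b" by simp
    show ?thesis
    proof (cases "Suc i < t")
      case True
      then show ?thesis using fv by blast
    next
      case False
      then have "Suc i = t" using i(1) by simp
      then show ?thesis using fv s unfolding s_def by simp
    qed
  qed
  moreover have bT: "b \<in> ?T" using \<open>t \<noteq> 0\<close> by (auto intro!: image_eqI[of _ _ 0])
  \<comment> \<open>Such a \<open>v\<close> differs from \<open>b\<close>, which is the first vertex
    of the tail.\<close>
  moreover have "\<exists>u\<in>V. f u = v" if "v \<in> V - (?T \<union> S)" for v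
    using that bT by (intro preimage) auto
  ultimately have V: "?T \<union> S = V"
    using cycle_subset funpow_closed[OF b(1)] by (intro closed_superset_eq) auto
  have disj: "?T \<inter> S = {}" using outside by auto
  have "card (?T \<union> S) = t + g"
    using disj card_cycle card_image[OF inj_tail] finite cycle_subset
    by (subst card_Un_disjoint) (auto intro: finite_subset)
  then have card: "card V = t + g" using V by simp
  then show "g < card V" using \<open>t \<noteq> 0\<close> by simp

  \<comment> \<open>The cycle is numbered from \<open>s\<close> along \<open>f\<close>, the tail
    against \<open>f\<close>: \<open>g\<close> is the last vertex before \<open>s\<close>, and
    \<open>t + g - 1\<close> is \<open>b\<close>.\<close>
  define \<phi> where "\<phi> i = (if i < g then (f ^^ i) s else (f ^^ (t + g - 1 - i)) b)" for i
  have "\<phi> ` {g..<t + g} = ?T"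
  proof -
    have "\<phi> ` {g..<t + g} = (\<lambda>i. (f ^^ i) b) ` (\<lambda>i. t + g - 1 - i) ` {g..<t + g}"
      unfolding image_image by (intro image_cong) (auto simp: \<phi>_def)
    also have "(\<lambda>i. t + g - 1 - i) ` {g..<t + g} = {..<t}"
    proof (intro set_eqI iffI)
      fix j assume "j \<in> {..<t}"
      then show "j \<in> (\<lambda>i. t + g - 1 - i) ` {g..<t + g}"
        by (intro image_eqI[of _ _ "t + g - 1 - j"]) auto
    qed auto
    finally show ?thesis .
  qed
  moreover have "\<phi> ` {..<g} = S"
    by (subst cycle_orbit[OF s]) (auto simp: \<phi>_def)
  moreover have "{..<card V} = {g..<t + g} \<union> {..<g}" unfolding card by auto
  ultimately have img: "\<phi> ` {..<card V} = V" using V by (simp add: image_Un)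
  \<comment> \<open>A map of \<open>{..<card V}\<close> onto \<open>V\<close> is injective by
    counting.\<close>
  then have bij: "bij_betw \<phi> {..<card V} V"
    unfolding bij_betw_def by (auto intro: eq_card_imp_inj_on)
  have "f (\<phi> i) = \<phi> (lasso_next g i)" if i: "i < card V" for i
  proof -
    consider "Suc i < g" | "Suc i = g" | "i = g" | "g < i" by linarith
    then show ?thesis
    proof cases
      case 1
      then show ?thesis by (simp add: \<phi>_def lasso_next_simps(1))
    next
      case 2
      then have "f (\<phi> i) = (f ^^ g) s" by (auto simp: \<phi>_def)
      then show ?thesis
        using 2 cycle_return[OF s] by (auto simp: \<phi>_def lasso_next_def)
    next
      case 3
      have "f (\<phi> i) = (f ^^ Suc (t - 1)) b" using 3 by (simp add: \<phi>_def)
      then show ?thesis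
        using 3 \<open>t \<noteq> 0\<close> cycle_length by (simp add: \<phi>_def lasso_next_simps(3) s_def)
    next
      case 4
      then have "Suc (t + g - 1 - i) = t + g - 1 - (i - 1)" using i card by simp
      moreover have "f (\<phi> i) = (f ^^ Suc (t + g - 1 - i)) b" using 4 by (simp add: \<phi>_def)
      ultimately have "f (\<phi> i) = (f ^^ (t + g - 1 - (i - 1))) b" by metis
      moreover have "\<not> i - 1 < g" using 4 by linarith
      ultimately show ?thesis using 4 unfolding \<phi>_def lasso_next_simps(4)[OF 4] by (simp only: if_False)
    qed
  qed
  then show "digraph_iso (with_proj (functional_graph V f)) (with_proj (cycle_pendant_path (card V) g))"
    unfolding cycle_pendant_path_eq_functional_graph[OF \<open>g < card V\<close>]
    using bij \<open>g < card V\<close> by (intro iso_lassoI[where \<phi> = \<phi>]) auto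
qed

end

section \<open>From a connected graph with a cycle to an attracting map\<close>

lemma graph_cycle_enumeration:
  assumes "pair_graph G" "graph_cycle G p"
  obtains \<sigma> where "inj_on \<sigma> {..<length p}"
    "\<And>i. i < length p \<Longrightarrow> (\<sigma> i, \<sigma> (Suc i mod length p)) \<in> parcs G"
proof -
  interpret pair_graph G by fact
  obtain u where u: "awalk u p u" "distinct (tl (pawalk_verts u p))" and len: "3 \<le> length p"
    using assms(2) unfolding graph_cycle_def cycle_def by auto
  have verts: "tl (pawalk_verts w q) = map snd q" if "pcas w q w'" for w q w'
  proof -
    have "pawalk_verts w q = w # map snd q" using that
      by (induction q arbitrary: w) auto
    then show ?thesis by simp
  qed
  have cas: "pcas u p u" and arcs: "set p \<subseteq> parcs G"
    using u(1) unfolding awalk_def by auto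
  have step: "fst (q ! i) = (w # map snd q) ! i" if "pcas w q w'" "i < length q" for w w' q i
    using that
  proof (induction q arbitrary: w i)
    case (Cons e q)
    then show ?case by (cases i) auto
  qed simp
  have last: "snd (last q) = w'" if "pcas w q w'" "q \<noteq> []" for w w' q
    using that by (induction q arbitrary: w) auto
  \<comment> \<open>The heads of the arcs are what \<open>tl (pawalk_verts u p)\<close> lists, so
    the distinctness required of a cycle is injectivity of \<open>\<sigma>\<close>.\<close>
  define \<sigma> where "\<sigma> i = snd (p ! i)" for i
  have "distinct (map snd p)" using u(2) verts[OF cas] by simp
  then have "inj_on \<sigma> {..<length p}"
    unfolding \<sigma>_def inj_on_def distinct_conv_nth by auto
  moreover have "(\<sigma> i, \<sigma> (Suc i mod length p)) \<in> parcs G" if i: "i < length p" for i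
  proof -
    let ?j = "Suc i mod length p"
    have j: "?j < length p" using len by (intro mod_less_divisor) linarith
    have "fst (p ! ?j) = \<sigma> i"
    proof (cases "Suc i = length p")
      case True
      \<comment> \<open>The walk is closed: its last arc ends at \<open>u\<close>, where arc 0
        starts.\<close>
      then have "snd (p ! i) = u"
        using last[OF cas] len by (metis diff_Suc_1 last_conv_nth length_0_conv not_less_eq_eq zero_le)
      then show ?thesis using True step[OF cas, of 0] j by (simp add: \<sigma>_def)
    next
      case False
      then show ?thesis using step[OF cas, of "Suc i"] i by (simp add: \<sigma>_def)
    qed
    then have "(\<sigma> i, \<sigma> ?j) = p ! ?j" unfolding \<sigma>_def by (simp add: prod_eq_iff)
    then show ?thesis using arcs j by auto
  qed
  ultimately show ?thesis using that by blast
qed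

lemma connected_distance:
  assumes "pair_graph G" "connected (with_proj G)" "S \<subseteq> pverts G" "S \<noteq> {}"
  obtains \<mu> :: "'a \<Rightarrow> nat"
  where "\<And>v. v \<in> pverts G - S \<Longrightarrow> \<exists>w. (v, w) \<in> parcs G \<and> \<mu> w < \<mu> v"
proof -
  interpret pair_graph G by fact
  \<comment> \<open>The length of a shortest walk from \<open>v\<close> into
    \<open>S\<close>.\<close>
  define \<mu> where "\<mu> v = (LEAST k. \<exists>s\<in>S. (v, s) \<in> parcs G ^^ k)" for v
  \<comment> \<open>The arcs are already symmetric, so the symmetric closure inside
    \<open>connected\<close> adds none.\<close>
  have sym: "parcs (mk_symmetric (with_proj G)) = parcs G"
    unfolding mk_symmetric_def using arcs_symmetric by auto
  have conn: "(u, v) \<in> (parcs G)\<^sup>*" if "u \<in> pverts G" "v \<in> pverts G" for u v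
  proof -
    have "u \<rightarrow>\<^sup>*\<^bsub>with_proj (mk_symmetric (with_proj G))\<^esub> v"
      using assms(2) that unfolding connected_def strongly_connected_def
      by (simp add: mk_symmetric_def)
    then show ?thesis
      unfolding reachable_def by (simp add: sym rtrancl_on_rtranclI)
  qed
  have "\<exists>w. (v, w) \<in> parcs G \<and> \<mu> w < \<mu> v" if v: "v \<in> pverts G - S" for v
  proof -
    have "\<exists>k. \<exists>s\<in>S. (v, s) \<in> parcs G ^^ k"
      using conn assms(3,4) v by (metis DiffD1 ex_in_conv rtrancl_power subset_eq)
    then have "\<exists>s\<in>S. (v, s) \<in> parcs G ^^ \<mu> v"
      unfolding \<mu>_def by (rule LeastI_ex)
    then obtain s where s: "s \<in> S" "(v, s) \<in> parcs G ^^ \<mu> v" by blast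
    have "\<mu> v \<noteq> 0" using s v by (metis DiffD2 relpow_0_E)
    then obtain k where k: "\<mu> v = Suc k" by (cases "\<mu> v") auto
    then obtain w where w: "(v, w) \<in> parcs G" "(w, s) \<in> parcs G ^^ k"
      using s(2) by (metis relpow_Suc_D2)
    \<comment> \<open>Dropping the first arc of a shortest walk leaves a walk of length
      \<open>k\<close> from \<open>w\<close>.\<close>
    have "\<mu> w \<le> k" unfolding \<mu>_def using w(2) s(1) by (blast intro: Least_le)
    then show ?thesis using w(1) k by auto
  qed
  then show ?thesis using that by blast
qed

text \<open>Two-cycles are impossible in each position: \<open>S\<close> is rotated with period at
  least 3, an orbit that enters \<open>S\<close> stays there, and outside \<open>S\<close> the rank
  drops.\<close>

lemma exists_attracting_cycle:
  assumes "pair_graph G" "connected (with_proj G)" "graph_cycle G p"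
  obtains f S \<mu> where "attracting_cycle (pverts G) f S (length p) \<mu>"
    "\<And>v. v \<in> pverts G \<Longrightarrow> (v, f v) \<in> parcs G"
proof -
  interpret pair_graph G by fact
  define g where "g = length p"
  have g: "3 \<le> g" using assms(3) by (simp add: g_def graph_cycle_def)
  obtain \<sigma> where inj: "inj_on \<sigma> {..<g}"
    and \<sigma>: "\<And>i. i < g \<Longrightarrow> (\<sigma> i, \<sigma> (Suc i mod g)) \<in> parcs G"
    using graph_cycle_enumeration[OF assms(1,3)] unfolding g_def by blast
  define S where "S = \<sigma> ` {..<g}"
  have S: "S \<subseteq> pverts G" "S \<noteq> {}"
    using \<sigma> wellformed'(1) g by (auto simp: S_def lessThan_empty_iff)
  obtain \<mu> :: "'a \<Rightarrow> nat" where \<mu>: "\<And>v. v \<in> pverts G - S \<Longrightarrow> \<exists>w. (v, w) \<in> parcs G \<and> \<mu> w < \<mu> v"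
    using connected_distance[OF assms(1,2) S] by blast
  then obtain h where h: "\<And>v. v \<in> pverts G - S \<Longrightarrow> (v, h v) \<in> parcs G \<and> \<mu> (h v) < \<mu> v"
    by metis
  define f where "f v = (if v \<in> S then \<sigma> (Suc (the_inv_into {..<g} \<sigma> v) mod g) else h v)" for v
  have f_\<sigma>: "f (\<sigma> i) = \<sigma> (Suc i mod g)" if "i < g" for i
    using that inj by (simp add: f_def S_def the_inv_into_f_f)
  have arc: "(v, f v) \<in> parcs G" if "v \<in> pverts G" for v
  proof (cases "v \<in> S")
    case True
    then show ?thesis using \<sigma> f_\<sigma> by (auto simp: S_def)
  qed (use h that in \<open>simp add: f_def\<close>)
  have funpow: "(f ^^ k) (\<sigma> i) = \<sigma> ((i + k) mod g)" if "i < g" for i k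
  proof (induction k)
    case (Suc k)
    have "(i + k) mod g < g" using g by simp
    then show ?case using Suc f_\<sigma> by (simp add: mod_Suc_eq)
  qed (use that in simp)
  have decr: "\<mu> (f v) < \<mu> v" if "v \<in> pverts G - S" for v
    using h[OF that] that by (simp add: f_def)
  have S_closed: "f v \<in> S" if "v \<in> S" for v
    using that f_\<sigma> g by (auto simp: S_def)
  have "attracting_cycle (pverts G) f S g \<mu>"
  proof
    show "finite (pverts G)" by (rule pair_finite_verts)
    show "f v \<in> pverts G" if "v \<in> pverts G" for v
      using arc[OF that] by (rule wellformed')
    show "f (f v) \<noteq> v" if v: "v \<in> pverts G" for v
    proof (cases "v \<in> S")
      case True
      then obtain i where i: "i < g" "v = \<sigma> i" by (auto simp: S_def)
      \<comment> \<open>This is where a cycle length of at least 3 is used.\<close>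
      have "(i + 2) mod g \<noteq> i"
        using i(1) g by (cases "i + 2 < g") (auto simp: mod_if)
      moreover have "f (f v) = (f ^^ 2) v" by (simp add: numeral_2_eq_2)
      ultimately show ?thesis
        using inj_onD[OF inj, of "(i + 2) mod g" i] i funpow[OF i(1)] by auto
    next
      case False
      show ?thesis
      proof (cases "f v \<in> S")
        case True
        then show ?thesis using S_closed False by metis
      next
        case notin: False
        have "f v \<in> pverts G" using arc[OF v] by (rule wellformed')
        then show ?thesis using decr[of v] decr[of "f v"] v False notin by force
      qed
    qed
    show "S \<subseteq> pverts G" by (rule S)
    show "card S = g" using inj by (simp add: S_def card_image)
    show "3 \<le> g" by (rule g)
    show "(f ^^ g) s = s" if "s \<in> S" for s
      using that funpow by (auto simp: S_def)
    show "S = (\<lambda>i. (f ^^ i) s) ` {..<g}" if s: "s \<in> S" for s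
    proof -
      obtain i where i: "i < g" "s = \<sigma> i" using s by (auto simp: S_def)
      have "(\<lambda>k. (i + k) mod g) ` {..<g} = {..<g}"
      proof (intro set_eqI iffI)
        fix j assume j: "j \<in> {..<g}"
        \<comment> \<open>The offset from \<open>i\<close> to \<open>j\<close>; adding
          \<open>g\<close> before subtracting \<open>i\<close> avoids truncation.\<close>
        have "(i + (j + g - i) mod g) mod g = (i + (j + g - i)) mod g"
          by (rule mod_add_right_eq)
        also have "\<dots> = j" using i(1) j by simp
        finally show "j \<in> (\<lambda>k. (i + k) mod g) ` {..<g}"
          using g by (intro image_eqI[of _ _ "(j + g - i) mod g"]) auto
      qed (use g in auto)
      moreover have "(\<lambda>k. (f ^^ k) s) ` {..<g} = \<sigma> ` (\<lambda>k. (i + k) mod g) ` {..<g}"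
        unfolding image_image using i funpow by simp
      ultimately show ?thesis by (simp add: S_def)
    qed
    show "\<mu> (f v) < \<mu> v" if "v \<in> pverts G - S" for v
      by (rule decr[OF that])
  qed
  then show ?thesis using that arc unfolding g_def by blast
qed

section \<open>The three alternatives and the final comparison\<close>

text \<open>\<open>p\<close> may be any cycle; the theorem supplies one whose length is the girth.
  If the third outcome fails, there are exactly \<open>2 * n\<close> arcs and at most one leaf, and
  the number of leaves decides between the first two.\<close>

lemma lasso_or_large_EUS:
  assumes "pair_graph G" "connected (with_proj G)" "graph_cycle G p"
  defines "n \<equiv> card (pverts G)" and "g \<equiv> length p"
  obtains "g = n" "digraph_iso (with_proj G) (with_proj (cycle_graph n))"
  | "g < n" "digraph_iso (with_proj G) (with_proj (cycle_pendant_path n g))"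
  | "2 * sqrt 3 * real n + 2 * sqrt 3 \<le> EUS G"
proof -
  interpret pair_graph G by fact
  let ?d = "out_degree (with_proj G)"
  obtain f S \<mu> where "attracting_cycle (pverts G) f S (length p) \<mu>"
    and arc: "\<And>v. v \<in> pverts G \<Longrightarrow> (v, f v) \<in> parcs G"
    using exists_attracting_cycle[OF assms(1-3)] by blast
  then interpret A: attracting_cycle "pverts G" f S g \<mu> by (simp add: g_def)
  let ?F = "functional_graph (pverts G) f"
  have sub: "parcs ?F \<subseteq> parcs G"
    using arc arcs_symmetric[OF arc] by (auto simp: A.parcs_iff)
  have card_F: "card (parcs ?F) = 2 * n"
    unfolding n_def by (rule A.card_parcs_functional_graph)
  have card_G: "2 * n \<le> card (parcs G)"
    using card_mono[OF pair_finite_arcs sub] card_F by simp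
  define L where "L = {v \<in> pverts G. ?d v = 1}"
  have deg: "1 \<le> ?d v" if "v \<in> pverts G" for v
  proof -
    have "finite {w. (v, w) \<in> parcs G}"
      by (rule finite_subset[OF _ pair_finite_verts]) (auto dest: wellformed')
    moreover have "f v \<in> {w. (v, w) \<in> parcs G}" using arc[OF that] by simp
    ultimately have "card {w. (v, w) \<in> parcs G} \<noteq> 0" by auto
    then show ?thesis by (simp add: out_degree_with_proj)
  qed
  have large: "2 * sqrt 3 * real n + 2 * sqrt 3 \<le> EUS G"
    if "4 * n + 4 + 6 * n \<le> 5 * card (parcs G) + 2 * card L"
  proof -
    have "2 * sqrt 3 * real n + 2 * sqrt 3 = sqrt 3 / 2 * (4 * real n + 4)"
      by (simp add: algebra_simps)
    also have "\<dots> \<le> sqrt 3 / 2 * (5 * real (card (parcs G)) - 6 * real n + 2 * real (card L))"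
      using that by (intro mult_left_mono) auto
    also have "\<dots> \<le> EUS G"
      unfolding n_def L_def using assms(1) deg by (rule EUS_ge_arcs_leaves)
    finally show ?thesis .
  qed
  show thesis
  proof (cases "card (parcs G) = 2 * n \<and> card L < 2")
    case False
    \<comment> \<open>The premise of \<open>large\<close> asks for \<open>10 * n + 4\<close>. One
      arc beyond \<open>2 * n\<close> contributes 5 more than \<open>10 * n\<close>, and two leaves
      contribute 4.\<close>
    then show thesis using card_G by (intro that(3) large) auto
  next
    case True
    \<comment> \<open>A subset of the same finite size is everything, so \<open>f\<close> accounts
      for all arcs of \<open>G\<close>.\<close>
    then have "parcs ?F = parcs G"
      using card_F by (intro card_subset_eq[OF pair_finite_arcs sub]) simp
    then have F: "?F = G"
      by (simp add: functional_graph_def)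
    have finite_pre: "finite {u \<in> pverts G. f u = v}" for v
      using pair_finite_verts by simp
    \<comment> \<open>In the graph of \<open>f\<close> the degree is one more than the number of
      preimages.\<close>
    have L_iff: "v \<in> L \<longleftrightarrow> (\<forall>u\<in>pverts G. f u \<noteq> v)" if "v \<in> pverts G" for v
      using that A.out_degree_functional_graph[OF that] finite_pre[of v]
      unfolding F L_def by auto
    have "finite L" using pair_finite_verts by (simp add: L_def)
    then consider "L = {}" | b where "L = {b}"
      using True by (metis card_1_singletonE card_eq_0_iff less_2_cases One_nat_def)
    then show thesis
    proof cases
      case 1
      then have "\<exists>u\<in>pverts G. f u = v" if "v \<in> pverts G" for v
        using L_iff[OF that] by blast
      then show thesis
        using A.iso_cycle_graph that(1) unfolding F n_def by metis
    next
      case 2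
      then have "b \<in> pverts G" by (auto simp: L_def)
      moreover from this have "f u \<noteq> b" if "u \<in> pverts G" for u
        using L_iff[of b] 2 that by blast
      moreover have "\<exists>u\<in>pverts G. f u = v" if "v \<in> pverts G" "v \<noteq> b" for v
        using L_iff[OF that(1)] 2 that by blast
      ultimately show thesis
        using A.iso_cycle_pendant_path[of b] that(2) unfolding F n_def by blast
    qed
  qed
qed

text \<open>The terms in \<open>x\<close> cancel, leaving
  \<open>2 * sqrt 19 + sqrt 13 < 8 * sqrt 3\<close> and
  \<open>3 * sqrt 19 + sqrt 7 < 10 * sqrt 3\<close>.\<close>

lemma EUS_pendant_values_less:
  fixes x :: real
  shows "2 * sqrt 3 * (x - 3) + 2 * sqrt 19 + sqrt 13 < 2 * sqrt 3 * x + 2 * sqrt 3"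
    and "3 * sqrt 19 + 2 * (x - 4) * sqrt 3 + sqrt 7 < 2 * sqrt 3 * x + 2 * sqrt 3"
proof -
  \<comment> \<open>These rational bounds reduce the two inequalities to 13 < 13.6 and 16.5 <
    17.\<close>
  have "17 / 10 \<le> sqrt 3"
    by (rule real_le_rsqrt) (simp add: power2_eq_square)
  moreover have "sqrt 19 \<le> 9 / 2" "sqrt 13 \<le> 4" "sqrt 7 \<le> 3"
    by (rule real_le_lsqrt; simp add: power2_eq_square)+
  ultimately have "2 * sqrt 19 + sqrt 13 < 8 * sqrt 3" "3 * sqrt 19 + sqrt 7 < 10 * sqrt 3"
    by simp_all
  then show "2 * sqrt 3 * (x - 3) + 2 * sqrt 19 + sqrt 13 < 2 * sqrt 3 * x + 2 * sqrt 3"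
    and "3 * sqrt 19 + 2 * (x - 4) * sqrt 3 + sqrt 7 < 2 * sqrt 3 * x + 2 * sqrt 3"
    by (simp_all add: algebra_simps)
qed

theorem theorem3:
  fixes G :: "'a pair_pre_digraph" and n g :: nat
  assumes "pair_graph G"
    and "connected (with_proj G)"
    and "card (pverts G) = n"
    and "n \<ge> 3"
    and "\<exists>p. graph_cycle G p"
    and "girth G = g"
  shows "(g = n \<longrightarrow>
            EUS G \<ge> 2 * sqrt 3 * real n \<and>
            (EUS G = 2 * sqrt 3 * real n
               \<longleftrightarrow> digraph_iso (with_proj G) (with_proj (cycle_graph n))))
       \<and> (g = n - 1 \<longrightarrow>
            EUS G \<ge> 2 * sqrt 3 * (real n - 3) + 2 * sqrt 19 + sqrt 13 \<and>
            (EUS G = 2 * sqrt 3 * (real n - 3) + 2 * sqrt 19 + sqrt 13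
               \<longleftrightarrow> digraph_iso (with_proj G) (with_proj (cycle_pendant_path n (n - 1)))))
       \<and> (g \<le> n - 2 \<longrightarrow>
            EUS G \<ge> 3 * sqrt 19 + 2 * (real n - 4) * sqrt 3 + sqrt 7 \<and>
            (EUS G = 3 * sqrt 19 + 2 * (real n - 4) * sqrt 3 + sqrt 7
               \<longleftrightarrow> digraph_iso (with_proj G) (with_proj (cycle_pendant_path n g))))"
proof -
  \<comment> \<open>As some cycle exists, the \<open>LEAST\<close> in \<open>girth\<close> is
    attained.\<close>
  have "\<exists>k p. graph_cycle G p \<and> length p = k" using assms(5) by blast
  from LeastI_ex[OF this] have "\<exists>p. graph_cycle G p \<and> length p = g"
    unfolding girth_def[symmetric] assms(6) .
  then obtain p where p: "graph_cycle G p" "length p = g" by blast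
  then have g: "3 \<le> g" by (simp add: graph_cycle_def)
  have EUS_cycle: "EUS G = 2 * sqrt 3 * real n"
    if "digraph_iso (with_proj G) (with_proj (cycle_graph n))"
    using EUS_digraph_iso[OF assms(1) pair_graph_cycle_graph[OF assms(4)] that]
      EUS_cycle_graph[OF assms(4)] by simp
  have EUS_pendant: "EUS G = (if g = n - 1 then 2 * sqrt 3 * (real n - 3) + 2 * sqrt 19 + sqrt 13
      else 3 * sqrt 19 + 2 * (real n - 4) * sqrt 3 + sqrt 7)"
    if "g < n" "digraph_iso (with_proj G) (with_proj (cycle_pendant_path n g))"
    using EUS_digraph_iso[OF assms(1) pair_graph_cycle_pendant_path[OF g that(1)] that(2)]
      EUS_cycle_pendant_path[OF g that(1)] by simp
  show ?thesis
  proof (rule lasso_or_large_EUS[OF assms(1,2) p(1), unfolded p(2) assms(3)])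
    assume "g = n" "digraph_iso (with_proj G) (with_proj (cycle_graph n))"
    then show ?thesis using EUS_cycle assms(4) by auto
  next
    assume "g < n" "digraph_iso (with_proj G) (with_proj (cycle_pendant_path n g))"
    \<comment> \<open>The conditions \<open>g = n - 1\<close> and \<open>g \<le> n - 2\<close>
      exclude each other for \<open>n\<close> at least 3, so the conditional in
      \<open>EUS_pendant\<close> selects the value of the clause that applies.\<close>
    then show ?thesis using EUS_pendant assms(4) by auto
  next
    assume large: "2 * sqrt 3 * real n + 2 * sqrt 3 \<le> EUS G"
    have "0 < sqrt 3" by simp
    then have cycle: "2 * sqrt 3 * real n < EUS G" using large by linarith
    note pendant = EUS_pendant_values_less[of "real n", THEN less_le_trans, OF large]
    \<comment> \<open>An isomorphism would force \<open>EUS G\<close> down to a value that it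
      strictly exceeds; hence both sides of each applicable equivalence are false.\<close>
    have "\<not> digraph_iso (with_proj G) (with_proj (cycle_graph n))"
      using EUS_cycle cycle by auto
    moreover have "\<not> digraph_iso (with_proj G) (with_proj (cycle_pendant_path n g))" if "g < n"
      using EUS_pendant[OF that] pendant by (auto split: if_splits)
    ultimately show ?thesis
      using cycle pendant assms(4) by auto
  qed
qed

end
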